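(* Let $\|\cdot\|$ be any norm on $\mathbb{R}^2$. Let $N(u):=\|(u,1)\|$ for real $u$, let $k:=\|(1,0)\|$, let $$c:=\lim_{u\to\infty}\big(\|(u,1)\|-2\|(u,0)\|+\|(u,-1)\|\big)$$ (a limit which exists and is finite and nonnegative), let $F:=\frac12+\frac1{2k}N'$, and let $F^{-1}(s):=\inf\{u\in\mathbb{R}\colon F(u)\ge s\}$ for $s\in(0,1)$. Define functions $\xi,\eta$ on $(0,1)$ by $$\xi(s):=\begin{cases}1&\text{if }0<s<\frac12,\\ 0&\text{if }\frac12\le s<1,\end{cases}\qquad \eta(s):=\begin{cases}-F^{-1}(2s)&\text{if }0<s<\frac12,\\ c&\text{if }\frac12\le s<1.\end{cases}$$ Then $$\|(u,v)\|=\int_0^1|u\,\xi(s)+v\,\eta(s)|\,\mathrm{d}s\quad\text{for all }(u,v)\in\mathbb{R}^2.$$ Thus, the mapping $(u,v)\mapsto u\,\xi+v\,\eta$ is a linear isometric imbedding of $\mathbb{R}^2$ (endowed with the arbitrary norm $\|\cdot\|$) into $L_1(0,1)$.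
   Context: The function $N$ is convex. For a convex function $f\colon\mathbb{R}\to\mathbb{R}$ with right and left derivatives $f'_+$ and $f'_-$, one defines $f':=(f'_++f'_-)/2$; this is the meaning of $N'$. The function $N'$ is nondecreasing and tends to $\pm k$ at $\pm\infty$, so $F$ is a cumulative probability distribution function, regularized in the sense that $2F(u)=F(u+)+F(u-)$ for all real $u$. The function $F^{-1}\colon(0,1)\to\mathbb{R}$ is the smallest, left-continuous generalized inverse to $F$. The space $L_1(0,1)$ is taken with respect to Lebesgue measure.
   Formalization: On (0,1/2) the formal statement takes ξ(s) = 2k and η(s) = −2k F^{-1}(2s) in place of 1 and −F^{-1}(2s): as printed, (u,v) = (1,0) gives ‖(1,0)‖ = 1/2, which fails e.g. for the Euclidean norm; for k = 1/2 the two versions coincide. *)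

theory Defs
  imports "HOL-Analysis.Analysis"
begin

definition is_norm :: "('a::real_vector \<Rightarrow> real) \<Rightarrow> bool" where
  "is_norm nrm \<longleftrightarrow>
     (\<forall>x. nrm x = 0 \<longleftrightarrow> x = 0) \<and>
     (\<forall>a x. nrm (a *\<^sub>R x) = \<bar>a\<bar> * nrm x) \<and>
     (\<forall>x y. nrm (x + y) \<le> nrm x + nrm y)"


subsection \<open>The normed space \<open>L\<^sub>1(0,1)\<close>\<close>

abbreviation leb01 :: "real measure" where
  "leb01 \<equiv> lebesgue_on {0<..<1}"

definition L1_eq :: "(real \<Rightarrow> real) \<Rightarrow> (real \<Rightarrow> real) \<Rightarrow> bool" where
  "L1_eq f g \<longleftrightarrow> integrable leb01 f \<and> integrable leb01 g \<and> (AE s in leb01. f s = g s)"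

lemma part_equivp_L1_eq: "part_equivp L1_eq"
proof (rule part_equivpI)
  show "\<exists>f. L1_eq f f"
    by (rule exI[of _ "\<lambda>_. 0"]) (simp add: L1_eq_def)
  show "symp L1_eq"
    by (auto intro!: sympI simp: L1_eq_def elim: eventually_mono)
  show "transp L1_eq"
    unfolding L1_eq_def by (rule transpI) (auto elim: eventually_elim2)
qed

text \<open>\<^term>\<open>L1_class f\<close> is the class of \<open>f\<close> modulo equality almost everywhere; it is
  meaningful only for integrable \<open>f\<close>.\<close>

quotient_type L1 = "real \<Rightarrow> real" / partial: L1_eq
  morphisms L1_rep L1_class
  by (rule part_equivp_L1_eq)

instantiation L1 :: real_normed_vector
begin

lift_definition zero_L1 :: L1 is "\<lambda>_. 0"
  by (simp add: L1_eq_def)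

lift_definition plus_L1 :: "L1 \<Rightarrow> L1 \<Rightarrow> L1" is "\<lambda>f g s. f s + g s"
  unfolding L1_eq_def by (auto elim: eventually_elim2)

lift_definition minus_L1 :: "L1 \<Rightarrow> L1 \<Rightarrow> L1" is "\<lambda>f g s. f s - g s"
  unfolding L1_eq_def by (auto elim: eventually_elim2)

lift_definition uminus_L1 :: "L1 \<Rightarrow> L1" is "\<lambda>f s. - f s"
  unfolding L1_eq_def by (auto elim: eventually_mono)

lift_definition scaleR_L1 :: "real \<Rightarrow> L1 \<Rightarrow> L1" is "\<lambda>a f s. a * f s"
  unfolding L1_eq_def by (auto elim: eventually_mono)

lift_definition norm_L1 :: "L1 \<Rightarrow> real" is "\<lambda>f. LINT s|leb01. \<bar>f s\<bar>"
  unfolding L1_eq_def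
  by (rule integral_cong_AE) (auto elim: eventually_mono)

definition dist_L1 :: "L1 \<Rightarrow> L1 \<Rightarrow> real" where
  "dist_L1 f g = norm (f - g)"

definition sgn_L1 :: "L1 \<Rightarrow> L1" where
  "sgn_L1 f = inverse (norm f) *\<^sub>R f"

definition uniformity_L1 :: "(L1 \<times> L1) filter" where
  "uniformity_L1 = (INF e\<in>{0<..}. principal {(f, g). dist f g < e})"

definition open_L1 :: "L1 set \<Rightarrow> bool" where
  "open_L1 U \<longleftrightarrow> (\<forall>f\<in>U. eventually (\<lambda>(f', g). f' = f \<longrightarrow> g \<in> U) uniformity)"

instance
proof
  fix f g h :: L1 and a b :: real
  show "f + g + h = f + (g + h)"
    by transfer (simp add: L1_eq_def algebra_simps)
  show "f + g = g + f"
    by transfer (simp add: L1_eq_def algebra_simps)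
  show "0 + f = f"
    by transfer (simp add: L1_eq_def)
  show "- f + f = 0"
    by transfer (simp add: L1_eq_def)
  show "f - g = f + - g"
    by transfer (simp add: L1_eq_def)
  show "a *\<^sub>R (f + g) = a *\<^sub>R f + a *\<^sub>R g"
    by transfer (simp add: L1_eq_def algebra_simps)
  show "(a + b) *\<^sub>R f = a *\<^sub>R f + b *\<^sub>R f"
    by transfer (simp add: L1_eq_def algebra_simps)
  show "a *\<^sub>R b *\<^sub>R f = (a * b) *\<^sub>R f"
    by transfer (simp add: L1_eq_def algebra_simps)
  show "1 *\<^sub>R f = f"
    by transfer (simp add: L1_eq_def)
  show "dist f g = norm (f - g)"
    by (rule dist_L1_def)
  show "sgn f = inverse (norm f) *\<^sub>R f"
    by (rule sgn_L1_def)
  show "uniformity = (INF e\<in>{0<..}. principal {(f :: L1, g). dist f g < e})"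
    by (rule uniformity_L1_def)
  show "open U \<longleftrightarrow> (\<forall>f\<in>U. eventually (\<lambda>(f', g). f' = f \<longrightarrow> g \<in> U) uniformity)"
    for U :: "L1 set"
    by (rule open_L1_def)
  show "norm f = 0 \<longleftrightarrow> f = 0"
    by transfer (simp add: L1_eq_def integral_nonneg_eq_0_iff_AE)
  show "norm (f + g) \<le> norm f + norm g"
  proof transfer
    fix f g :: "real \<Rightarrow> real"
    assume "L1_eq f f" "L1_eq g g"
    then have int: "integrable leb01 f" "integrable leb01 g"
      by (auto simp: L1_eq_def)
    then have "(LINT s|leb01. \<bar>f s + g s\<bar>) \<le> (LINT s|leb01. \<bar>f s\<bar> + \<bar>g s\<bar>)"
      by (intro integral_mono) (auto intro: abs_triangle_ineq)
    also have "\<dots> = (LINT s|leb01. \<bar>f s\<bar>) + (LINT s|leb01. \<bar>g s\<bar>)"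
      using int by (intro Bochner_Integration.integral_add) auto
    finally show "(LINT s|leb01. \<bar>f s + g s\<bar>) \<le> \<dots>" .
  qed
  show "norm (a *\<^sub>R f) = \<bar>a\<bar> * norm f"
    by transfer (simp add: abs_mult)
qed

end


subsection \<open>The data attached to a norm on the plane\<close>

text \<open>The two one-sided derivatives exist at every point when \<open>f\<close> is convex.\<close>

definition mean_deriv :: "(real \<Rightarrow> real) \<Rightarrow> real \<Rightarrow> real" where
  "mean_deriv f x =
     (vector_derivative f (at_right x) + vector_derivative f (at_left x)) / 2"

definition N :: "(real \<times> real \<Rightarrow> real) \<Rightarrow> real \<Rightarrow> real" where
  "N nrm u = nrm (u, 1)"

definition k :: "(real \<times> real \<Rightarrow> real) \<Rightarrow> real" where
  "k nrm = nrm (1, 0)"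

definition c_fun :: "(real \<times> real \<Rightarrow> real) \<Rightarrow> real \<Rightarrow> real" where
  "c_fun nrm u = nrm (u, 1) - 2 * nrm (u, 0) + nrm (u, -1)"

definition c :: "(real \<times> real \<Rightarrow> real) \<Rightarrow> real" where
  "c nrm = Lim at_top (c_fun nrm)"

definition F :: "(real \<times> real \<Rightarrow> real) \<Rightarrow> real \<Rightarrow> real" where
  "F nrm u = 1 / 2 + 1 / (2 * k nrm) * mean_deriv (N nrm) u"

definition F_inv :: "(real \<times> real \<Rightarrow> real) \<Rightarrow> real \<Rightarrow> real" where
  "F_inv nrm s = Inf {u. F nrm u \<ge> s}"

text \<open>The factor \<^term>\<open>2 * k nrm\<close> on \<open>(0, 1/2)\<close> is forced by the representation of
  \<^term>\<open>nrm (1, 0)\<close>: without it (that is, with the values \<open>1\<close> and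
  \<^term>\<open>- F_inv nrm (2 * s)\<close> there) the representation can hold only when
  \<^term>\<open>k nrm = 1 / 2\<close>, see \<open>unscaled_imp_half\<close> below.\<close>

definition xi :: "(real \<times> real \<Rightarrow> real) \<Rightarrow> real \<Rightarrow> real" where
  "xi nrm s = (if s < 1 / 2 then 2 * k nrm else 0)"

definition eta :: "(real \<times> real \<Rightarrow> real) \<Rightarrow> real \<Rightarrow> real" where
  "eta nrm s = (if s < 1 / 2 then - (2 * k nrm) * F_inv nrm (2 * s) else c nrm)"

lemma unscaled_imp_half:
  fixes h :: "real \<Rightarrow> real"
  assumes "\<And>u v. nrm (u, v) = (LINT s|leb01. \<bar>u * (if s < 1 / 2 then 1 else 0) + v * h s\<bar>)"
  shows "k nrm = 1 / 2"
proof -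
  have "k nrm = (LINT s|leb01. indicator {0<..<1/2} s)"
    unfolding k_def assms
    by (rule Bochner_Integration.integral_cong) (auto simp: indicator_def)
  also have "\<dots> = measure leb01 ({0<..<1/2} \<inter> space leb01)"
    by simp
  also have "{0<..<1/2} \<inter> space leb01 = {0<..<1/2::real}"
    by auto
  also have "measure leb01 {0<..<1/2::real} = 1 / 2"
    by (subst measure_restrict_space) auto
  finally show ?thesis .
qed

end

theory Submission
  imports Defs
begin

text \<open>
  By homogeneity everything is decided on the line \<open>v = 1\<close>, where the claim reads
  \<open>N(u) = 2k \<integral> \<bar>u - q(s)\<bar> ds + c/2\<close> with \<open>q(s) = F\<^sup>-\<^sup>1(2s)\<close> and the integral taken over
  \<open>(0, 1/2)\<close>; the constant \<open>c/2\<close> is the contribution of the other half of the unit interval.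

  Both sides have the same increments. Convexity of \<open>N\<close> puts its slope over an interval \<open>[a, b]\<close>
  between \<open>N'(a) = k (2 F(a) - 1)\<close> and \<open>N'(b)\<close> (\<open>mean_deriv_between\<close>).
  The inequalities \<open>q(s) \<le> a\<close> for \<open>2s \<le> F(a)\<close> and \<open>b \<le> q(s)\<close> for \<open>2s > F(b)\<close>, integrated over
  \<open>s\<close>, enclose the slope of the right-hand side between the same two numbers
  (\<open>integral_increment_between\<close>). Hence the increment over \<open>[a, b]\<close> of the difference of the two
  sides is at most \<open>(b - a) (N'(b) - N'(a))\<close> in absolute value, and subdividing \<open>[a, b]\<close> makes this
  bound arbitrarily small: the difference is constant (\<open>constant_if_dominated_increments\<close>).

  The increments \<open>\<bar>b - q\<bar> - \<bar>a - q\<bar>\<close> are bounded, so up to here \<open>q\<close> may have infinite mean.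
  Adding the increments from \<open>0\<close> to \<open>r\<close> and from \<open>0\<close> to \<open>-r\<close> gives the integral of
  \<open>min r \<bar>q\<bar>\<close> in terms of \<open>N(r) + N(-r) - 2kr\<close>, whose limit is \<open>c\<close>
  (\<open>integral_truncated\<close>). Monotone convergence then yields at one stroke that \<open>q\<close> is integrable
  and that the additive constant is \<open>c/2\<close> (\<open>quantile_first_moment\<close>).
\<close>

section \<open>One-sided derivatives of a convex function\<close>

lemma slope_commute:
  fixes f :: "real \<Rightarrow> real"
  shows "(f x - f y) / (x - y) = (f y - f x) / (y - x)"
  using minus_divide_divide[of "f x - f y" "x - y"] by simp

text \<open>The slopes from \<open>x\<close> decrease as \<open>y\<close> decreases to \<open>x\<close>, and the slope over \<open>[x - 1, x]\<close>
  bounds them from below, so they converge to their infimum.\<close>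

lemma convex_right_slope_tendsto:
  fixes f :: "real \<Rightarrow> real"
  assumes "convex_on UNIV f"
  shows "\<exists>d. ((\<lambda>y. (f y - f x) / (y - x)) \<longlongrightarrow> d) (at_right x)"
proof -
  define sl where "sl y = (f y - f x) / (y - x)" for y
  have mono: "sl y \<le> sl z" if "x < y" "y \<le> z" for y z
  proof (cases "y = z")
    case False
    with that have "(f x - f y) / (x - y) \<le> (f x - f z) / (x - z)"
      using convex_on_slope_le(1)[OF assms, of x z y] by simp
    then show ?thesis
      by (simp add: sl_def slope_commute[of f x])
  qed simp
  have lower: "f x - f (x - 1) \<le> sl y" if "x < y" for y
  proof -
    have "f x - f (x - 1) = (f (x - 1) - f x) / ((x - 1) - x)"
      by simp
    also have "\<dots> \<le> (f x - f y) / (x - y)"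
      using that order_trans[OF convex_on_slope_le[OF assms, of "x - 1" y x]] by simp
    also have "\<dots> = sl y"
      unfolding sl_def by (rule slope_commute)
    finally show ?thesis .
  qed
  define d where "d = Inf (sl ` {x<..})"
  have bdd: "bdd_below (sl ` {x<..})"
    using lower by (auto intro!: bdd_belowI)
  have "(sl \<longlongrightarrow> d) (at_right x)"
  proof (rule order_tendstoI)
    fix e assume "e < d"
    have "e < sl y" if "x < y" for y
      using cInf_lower[OF _ bdd, of "sl y"] that \<open>e < d\<close> unfolding d_def by fastforce
    then show "\<forall>\<^sub>F y in at_right x. e < sl y"
      by (auto simp: eventually_at_filter)
  next
    fix e assume "d < e"
    then obtain y where y: "x < y" "sl y < e"
      using cInf_lessD[of "sl ` {x<..}" e] unfolding d_def by auto
    have "sl z < e" if "x < z" "z < y" for z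
      using mono[of z y] that y by linarith
    then show "\<forall>\<^sub>F y in at_right x. sl y < e"
      using y(1) unfolding eventually_at_right_field by blast
  qed
  then show ?thesis
    unfolding sl_def by blast
qed

lemma convex_on_reflect:
  fixes f :: "real \<Rightarrow> real"
  assumes "convex_on UNIV f"
  shows "convex_on UNIV (\<lambda>x. f (- x))"
proof (rule convex_onI)
  fix t x y :: real assume "0 < t" "t < 1"
  then show "f (- ((1 - t) *\<^sub>R x + t *\<^sub>R y)) \<le> (1 - t) * f (- x) + t * f (- y)"
    using convex_onD[OF assms, of t "-x" "-y"] by (simp add: algebra_simps)
qed simp

lemma convex_left_slope_tendsto:
  fixes f :: "real \<Rightarrow> real"
  assumes "convex_on UNIV f"
  shows "\<exists>d. ((\<lambda>y. (f y - f x) / (y - x)) \<longlongrightarrow> d) (at_left x)"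
proof -
  obtain d where "((\<lambda>y. (f (- y) - f x) / (y - - x)) \<longlongrightarrow> d) (at_right (- x))"
    using convex_right_slope_tendsto[OF convex_on_reflect[OF assms], of "- x"] by auto
  then have "((\<lambda>y. - ((f (- y) - f x) / (y - - x))) \<longlongrightarrow> - d) (at_right (- x))"
    by (rule tendsto_minus)
  moreover have "(\<lambda>y. - ((f (- y) - f x) / (y - - x))) = (\<lambda>y. (f (- y) - f x) / (- y - x))"
    
  proof
    fix y
    have "- y - x = - (y - - x)"
      by simp
    then show "- ((f (- y) - f x) / (y - - x)) = (f (- y) - f x) / (- y - x)"
      by (simp only: divide_minus_right)
  qed
  ultimately show ?thesis
    unfolding filterlim_at_left_to_right by metis
qed

text \<open>Both one-sided derivatives obey the bounds, since they are limits of slopes that by convexity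
  lie on the correct side of the slope over \<open>[a, b]\<close>; their mean inherits the bounds.\<close>

lemma mean_deriv_between:
  fixes f :: "real \<Rightarrow> real"
  assumes f: "convex_on UNIV f" and "a < b"
  shows "(b - a) * mean_deriv f a \<le> f b - f a" "f b - f a \<le> (b - a) * mean_deriv f b"
proof -
  have deriv: "((\<lambda>y. (f y - f x) / (y - x)) \<longlongrightarrow> vector_derivative f (at x within S)) (at x within S)"
    if "S = {x<..} \<or> S = {..<x}" for x S
  proof -
    from that obtain d where d: "((\<lambda>y. (f y - f x) / (y - x)) \<longlongrightarrow> d) (at x within S)"
      using convex_right_slope_tendsto[OF f, of x] convex_left_slope_tendsto[OF f, of x] by auto
    then have "(f has_vector_derivative d) (at x within S)"
      unfolding has_real_derivative_iff_has_vector_derivative[symmetric]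
      by (simp add: has_field_derivative_iff)
    moreover have "at x within S \<noteq> bot"
      using that by (auto simp: trivial_limit_at_left_real trivial_limit_at_right_real)
    ultimately show ?thesis
      using d vector_derivative_within by metis
  qed
  define sl where "sl x y = (f y - f x) / (y - x)" for x y
  have sl_sym: "sl x y = sl y x" for x y
    unfolding sl_def by (rule slope_commute)
  have sl_mono: "sl x t \<le> sl x y" "sl x y \<le> sl t y" if "x < t" "t < y" for x t y
    using convex_on_slope_le[OF f _ _ that] unfolding sl_def slope_commute[of f x]
    by (simp_all add: slope_commute[of f t y])
  define m where "m = sl a b"
  have R: "sl a y \<le> m" if "a < y" "y < b" for y
    using sl_mono(1)[OF that] by (simp add: m_def)
  have L: "sl a y \<le> m" if "y < a" for y
    using sl_mono[OF that \<open>a < b\<close>] sl_sym[of a y] by (simp add: m_def)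
  have R': "m \<le> sl b y" if "b < y" for y
    using sl_mono[OF \<open>a < b\<close> that] by (simp add: m_def)
  have L': "m \<le> sl b y" if "a < y" "y < b" for y
    using sl_mono(2)[OF that] sl_sym[of b y] by (simp add: m_def)
  have "vector_derivative f (at_right a) \<le> m"
    by (rule tendsto_upperbound[OF deriv])
       (use \<open>a < b\<close> R in \<open>auto simp: sl_def[symmetric] eventually_at_right_field\<close>)
  moreover have "vector_derivative f (at_left a) \<le> m"
    by (rule tendsto_upperbound[OF deriv]) (use L in \<open>auto simp: sl_def[symmetric] eventually_at_filter\<close>)
  ultimately have "mean_deriv f a \<le> m"
    by (simp add: mean_deriv_def)
  then show "(b - a) * mean_deriv f a \<le> f b - f a"
    using \<open>a < b\<close> by (simp add: m_def sl_def field_simps)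
  have "m \<le> vector_derivative f (at_right b)"
    by (rule tendsto_lowerbound[OF deriv]) (use R' in \<open>auto simp: sl_def[symmetric] eventually_at_filter\<close>)
  moreover have "m \<le> vector_derivative f (at_left b)"
    by (rule tendsto_lowerbound[OF deriv])
       (use \<open>a < b\<close> L' in \<open>auto simp: sl_def[symmetric] eventually_at_left_field\<close>)
  ultimately have "m \<le> mean_deriv f b"
    by (simp add: mean_deriv_def)
  then show "f b - f a \<le> (b - a) * mean_deriv f b"
    using \<open>a < b\<close> by (simp add: m_def sl_def field_simps)
qed

text \<open>Halving the interval halves the bound: the factor \<open>b - a\<close> is halved while the increments of
  \<open>g\<close> over the two halves add up to that over the whole interval.\<close>

lemma constant_if_dominated_increments:
  fixes D g :: "real \<Rightarrow> real"
  assumes dom: "\<And>a b. a < b \<Longrightarrow> \<bar>D b - D a\<bar> \<le> (b - a) * (g b - g a)"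
    and "a < b"
  shows "D b = D a"
proof -
  have refined: "\<bar>D y - D x\<bar> \<le> (y - x) * (g y - g x) / 2 ^ n" if "x < y" for x y n
    using that
  proof (induction n arbitrary: x y)
    case 0
    then show ?case using dom by simp
  next
    case (Suc n)
    define m where "m = (x + y) / 2"
    have m: "x < m" "m < y" "m - x = (y - x) / 2" "y - m = (y - x) / 2"
      using Suc.prems by (auto simp: m_def field_simps)
    have "\<bar>D y - D x\<bar> \<le> \<bar>D y - D m\<bar> + \<bar>D m - D x\<bar>"
      by linarith
    also have "\<dots> \<le> (y - m) * (g y - g m) / 2 ^ n + (m - x) * (g m - g x) / 2 ^ n"
      by (intro add_mono Suc.IH m)
    also have "\<dots> = (y - x) * (g y - g x) / 2 ^ Suc n"
      unfolding m by (simp add: field_simps)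
    finally show ?case .
  qed
  have "(\<lambda>n. (b - a) * (g b - g a) * inverse (2 ^ n)) \<longlonglongrightarrow> (b - a) * (g b - g a) * 0"
    by (intro tendsto_intros LIMSEQ_inverse_realpow_zero) simp
  then have "\<bar>D b - D a\<bar> \<le> 0"
    by (intro tendsto_lowerbound[of "\<lambda>n. (b - a) * (g b - g a) * inverse (2 ^ n)"])
       (auto simp: refined[OF \<open>a < b\<close>] divide_inverse[symmetric])
  then show ?thesis by simp
qed

section \<open>Integration over the left half of the unit interval\<close>

abbreviation half :: "real measure" where
  "half \<equiv> lebesgue_on {0<..<1 / 2}"

lemma half_const: "integrable half (\<lambda>_. d :: real)" "(LINT s|half. d) = d / 2"
proof -
  have m: "measure half (space half) = 1 / 2"
    by (subst measure_restrict_space) auto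
  have "emeasure half (space half) \<noteq> \<infinity>"
    by (subst emeasure_restrict_space) auto
  then interpret finite_measure half
    by (rule finite_measureI)
  show "integrable half (\<lambda>_. d)"
    by simp
  show "(LINT s|half. d) = d / 2"
    using m by simp
qed

lemma half_initial_segment:
  assumes "0 \<le> x" "x \<le> 1"
  shows "integrable half (\<lambda>s. indicator {..x / 2} s :: real)"
    "(LINT s|half. indicator {..x / 2} s) = x / 2"
proof -
  have meas: "(\<lambda>s. indicator {..x / 2} s :: real) \<in> borel_measurable half"
    by (intro measurable_restrict_space1 borel_measurable_indicator) simp
  show "integrable half (\<lambda>s. indicator {..x / 2} s :: real)"
    by (rule Bochner_Integration.integrable_bound[OF half_const(1)[of 1] meas]) simp
  have "(LINT s|half. indicator {..x / 2} s) = measure half ({..x / 2} \<inter> space half)"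
    by simp
  also have "\<dots> = measure lebesgue ({0<..<1 / 2} \<inter> {..x / 2})"
    by (subst measure_restrict_space) (auto simp: Int_commute)
  also have "\<dots> = x / 2"
  proof (cases "x = 1")
    case True
    then have "{0<..<1 / 2} \<inter> {..x / 2} = {0<..<1 / 2}" by auto
    with True show ?thesis by simp
  next
    case False
    then have "{0<..<1 / 2} \<inter> {..x / 2} = {0<..x / 2}" using assms by auto
    with assms show ?thesis by simp
  qed
  finally show "(LINT s|half. indicator {..x / 2} s) = x / 2" .
qed

text \<open>The functions of the theorem are constant on \<open>[1/2, 1)\<close>, so that half of the interval
  contributes only an additive constant.\<close>

lemma leb01_splice:
  fixes f :: "real \<Rightarrow> real"
  assumes "integrable half f"
  shows "integrable leb01 (\<lambda>s. if s < 1 / 2 then f s else d)"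
    "(LINT s|leb01. (if s < 1 / 2 then f s else d)) = (LINT s|half. f s) + d / 2"
proof -
  have half: "half = restrict_space leb01 {0<..<1 / 2}"
    by (subst restrict_restrict_space) (auto intro!: arg_cong[where f = "restrict_space lebesgue"])
  have A: "{0<..<1 / 2} \<inter> space leb01 \<in> sets leb01"
    by (auto simp: sets_restrict_space)
  have split: "(if s < 1 / 2 then f s else d) =
      indicator {0<..<1 / 2} s *\<^sub>R f s + (d - indicator {0<..<1 / 2} s *\<^sub>R d)"
    if "s \<in> space leb01" for s
    using that by (auto simp: indicator_def)
  have "emeasure leb01 (space leb01) \<noteq> \<infinity>"
    by (subst emeasure_restrict_space) auto
  then interpret finite_measure leb01
    by (rule finite_measureI)
  have int_d: "integrable leb01 (\<lambda>_. d)"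
    by simp
  have m: "measure leb01 (space leb01) = 1"
    by (subst measure_restrict_space) auto
  have d1: "(LINT s|leb01. d) = d"
    using m by simp
  have int_f: "integrable leb01 (\<lambda>s. indicator {0<..<1 / 2} s *\<^sub>R f s)"
    using assms unfolding half integrable_restrict_space[OF A] .
  have int_c: "integrable leb01 (\<lambda>s. indicator {0<..<1 / 2} s *\<^sub>R d)"
    using half_const(1)[of d] unfolding half integrable_restrict_space[OF A] .
  note int_rest = Bochner_Integration.integrable_diff[OF int_d int_c]
  show "integrable leb01 (\<lambda>s. if s < 1 / 2 then f s else d)"
    using Bochner_Integration.integrable_add[OF int_f int_rest]
    by (subst Bochner_Integration.integrable_cong[OF refl split])
  have "(LINT s|leb01. (if s < 1 / 2 then f s else d)) =
      (LINT s|leb01. indicator {0<..<1 / 2} s *\<^sub>R f s) +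
      ((LINT s|leb01. d) - (LINT s|leb01. indicator {0<..<1 / 2} s *\<^sub>R d))"
    by (simp only: Bochner_Integration.integral_cong[OF refl split]
        Bochner_Integration.integral_add[OF int_f int_rest]
        Bochner_Integration.integral_diff[OF int_d int_c])
  also have "\<dots> = (LINT s|half. f s) + (d - (LINT s|half. d))"
    unfolding half integral_restrict_space[OF A] d1 ..
  finally show "(LINT s|leb01. (if s < 1 / 2 then f s else d)) = (LINT s|half. f s) + d / 2"
    unfolding half_const(2) by simp
qed

section \<open>The distribution function of a norm\<close>

locale plane_norm =
  fixes nrm :: "real \<times> real \<Rightarrow> real"
  assumes is_norm: "is_norm nrm"
begin

lemma triangle: "nrm (x + y, z + w) \<le> nrm (x, z) + nrm (y, w)"
  using is_norm unfolding is_norm_def by (metis add_Pair)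

lemma homogeneous: "nrm (a * x, a * y) = \<bar>a\<bar> * nrm (x, y)"
  using is_norm unfolding is_norm_def by (metis scaleR_Pair real_scaleR_def)

lemma horizontal: "nrm (u, 0) = k nrm * \<bar>u\<bar>"
  using homogeneous[of u 1 0] by (simp add: k_def)

lemma nonneg: "0 \<le> nrm (x, y)"
  using triangle[of x "- x" y "- y"] homogeneous[of "-1" x y] homogeneous[of 0 0 0] by simp

lemma k_pos: "0 < k nrm"
proof -
  have "nrm (1, 0) \<noteq> 0"
    using is_norm unfolding is_norm_def by (simp add: zero_prod_def)
  then show ?thesis using nonneg[of 1 0] by (simp add: k_def)
qed

lemma N_lipschitz: "N nrm b \<le> N nrm a + k nrm * \<bar>b - a\<bar>"
  using triangle[of a "b - a" 1 0] horizontal[of "b - a"] by (simp add: N_def)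

lemma N_lower: "k nrm * \<bar>u\<bar> - N nrm 0 \<le> N nrm u"
  using triangle[of u 0 1 "-1"] horizontal[of u] homogeneous[of "-1" 0 1] by (simp add: N_def)

lemma N_convex: "convex_on UNIV (N nrm)"
proof (rule convex_onI)
  fix t x y :: real assume t: "0 < t" "t < 1"
  have "N nrm ((1 - t) *\<^sub>R x + t *\<^sub>R y)
      = nrm ((1 - t) * x + t * y, (1 - t) * 1 + t * 1)"
    by (simp add: N_def)
  also have "\<dots> \<le> nrm ((1 - t) * x, (1 - t) * 1) + nrm (t * y, t * 1)"
    by (rule triangle)
  also have "\<dots> = (1 - t) * N nrm x + t * N nrm y"
    unfolding homogeneous using t by (simp add: N_def)
  finally show "N nrm ((1 - t) *\<^sub>R x + t *\<^sub>R y) \<le> (1 - t) * N nrm x + t * N nrm y" .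
qed simp

lemma c_fun_N: "0 \<le> u \<Longrightarrow> c_fun nrm u = N nrm u + N nrm (- u) - 2 * k nrm * u"
  using homogeneous[of "-1" u "-1"] horizontal[of u] by (simp add: c_fun_def N_def)

lemma c_fun_nonneg: "0 \<le> c_fun nrm u"
  using triangle[of u u 1 "-1"] horizontal[of "2 * u"] horizontal[of u]
  by (simp add: c_fun_def)

text \<open>\<open>N(u) - ku\<close> and \<open>N(-u) - ku\<close> both decrease, because \<open>N\<close> is Lipschitz with constant \<open>k\<close>.\<close>

lemma c_fun_antimono:
  assumes "0 \<le> u" "u \<le> v"
  shows "c_fun nrm v \<le> c_fun nrm u"
  using N_lipschitz[of v u] N_lipschitz[of "- v" "- u"] assms
  by (simp add: c_fun_N algebra_simps)

lemma c_fun_tendsto: "(c_fun nrm \<longlongrightarrow> c nrm) at_top"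
proof -
  define l where "l = Inf (c_fun nrm ` {0..})"
  have bdd: "bdd_below (c_fun nrm ` {0..})"
    by (rule bdd_belowI2[of _ 0]) (rule c_fun_nonneg)
  have "(c_fun nrm \<longlongrightarrow> l) at_top"
  proof (rule order_tendstoI)
    fix e assume "e < l"
    have "e < c_fun nrm u" if "0 \<le> u" for u
      using cInf_lower[OF _ bdd, of "c_fun nrm u"] that \<open>e < l\<close> unfolding l_def by fastforce
    then show "\<forall>\<^sub>F u in at_top. e < c_fun nrm u"
      unfolding eventually_at_top_linorder by blast
  next
    fix e assume "l < e"
    then obtain u where u: "0 \<le> u" "c_fun nrm u < e"
      using cInf_lessD[of "c_fun nrm ` {0..}" e] unfolding l_def by auto
    have "c_fun nrm v < e" if "u \<le> v" for v
      using c_fun_antimono[OF u(1) that] u(2) by linarith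
    then show "\<forall>\<^sub>F u in at_top. c_fun nrm u < e"
      unfolding eventually_at_top_linorder by blast
  qed
  then show ?thesis
    unfolding c_def by (metis tendsto_Lim trivial_limit_at_top_linorder)
qed

lemma c_nonneg: "0 \<le> c nrm"
  by (rule tendsto_lowerbound[OF c_fun_tendsto]) (simp_all add: c_fun_nonneg)

lemma mean_deriv_F: "mean_deriv (N nrm) u = k nrm * (2 * F nrm u - 1)"
  using k_pos by (simp add: F_def field_simps)

lemma F_increment:
  assumes "a < b"
  shows "k nrm * ((b - a) * (2 * F nrm a - 1)) \<le> N nrm b - N nrm a"
    "N nrm b - N nrm a \<le> k nrm * ((b - a) * (2 * F nrm b - 1))"
  using mean_deriv_between[OF N_convex assms] by (simp_all add: mean_deriv_F mult_ac)

lemma F_mono: assumes "a \<le> b" shows "F nrm a \<le> F nrm b"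
proof (cases "a = b")
  case False
  then have "k nrm * ((b - a) * (2 * F nrm a - 1)) \<le> k nrm * ((b - a) * (2 * F nrm b - 1))"
    using F_increment[of a b] assms by linarith
  then show ?thesis using k_pos False assms by simp
qed simp

lemma F_bounds: "0 \<le> F nrm u" "F nrm u \<le> 1"
proof -
  have "k nrm * (2 * F nrm u - 1) \<le> k nrm * 1"
    using F_increment(1)[of u "u + 1"] N_lipschitz[of "u + 1" u] by simp
  then show "F nrm u \<le> 1"
    unfolding mult_le_cancel_left_pos[OF k_pos] by simp
  have "k nrm * (-1) \<le> k nrm * (2 * F nrm u - 1)"
    using F_increment(2)[of "u - 1" u] N_lipschitz[of "u - 1" u] by simp
  then show "0 \<le> F nrm u"
    unfolding mult_le_cancel_left_pos[OF k_pos] by simp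
qed

text \<open>A quantitative form of \<open>N'(u) \<longlongrightarrow> \<plusminus>k\<close>: compare the derivative at \<open>\<plusminus>u\<close> with the slope over
  the interval between \<open>0\<close> and \<open>\<plusminus>u\<close>. It makes the infimum that defines the quantile finite.\<close>

lemma F_tails:
  assumes "0 < u"
  shows "1 - N nrm 0 / (k nrm * u) \<le> F nrm u" "F nrm (- u) \<le> N nrm 0 / (k nrm * u)"
  using F_increment(2)[of 0 u] F_increment(1)[of "- u" 0] N_lower[of u] N_lower[of "- u"] assms k_pos
  by (simp_all add: field_simps)

lemma superlevel:
  assumes "0 < t" "t < 1"
  shows "{u. t \<le> F nrm u} \<noteq> {}" "bdd_below {u. t \<le> F nrm u}"
proof -
  have small: "\<exists>u>0. N nrm 0 / (k nrm * u) < e" if "0 < e" for e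
  proof -
    define u where "u = (N nrm 0 + 1) / (k nrm * e)"
    have "0 \<le> N nrm 0" using nonneg by (simp add: N_def)
    then have "0 < u" "N nrm 0 < e * (k nrm * u)"
      using k_pos that by (simp_all add: u_def)
    then show ?thesis using k_pos by (auto simp: pos_divide_less_eq)
  qed
  obtain u where "0 < u" "N nrm 0 / (k nrm * u) < 1 - t"
    using small[of "1 - t"] assms by auto
  with F_tails(1)[of u] show "{u. t \<le> F nrm u} \<noteq> {}"
    by (auto intro!: exI[of _ u])
  obtain u where u: "0 < u" "N nrm 0 / (k nrm * u) < t"
    using small[of t] assms by auto
  show "bdd_below {u. t \<le> F nrm u}"
  proof (rule bdd_belowI[of _ "- u"])
    fix x assume "x \<in> {u. t \<le> F nrm u}"
    then show "- u \<le> x"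
      using F_mono[of x "- u"] F_tails(2)[of u] u by force
  qed
qed

lemma F_inv_le: "0 < t \<Longrightarrow> t < 1 \<Longrightarrow> t \<le> F nrm u \<Longrightarrow> F_inv nrm t \<le> u"
  unfolding F_inv_def using superlevel(2) by (auto intro: cInf_lower)

lemma le_F_inv:
  assumes "0 < t" "t < 1" "F nrm u < t"
  shows "u \<le> F_inv nrm t"
  unfolding F_inv_def
proof (rule cInf_greatest[OF superlevel(1)[OF assms(1,2)]])
  fix x assume "x \<in> {u. t \<le> F nrm u}"
  then show "u \<le> x" using F_mono[of x u] assms by force
qed

lemma F_inv_mono: "0 < s \<Longrightarrow> s \<le> t \<Longrightarrow> t < 1 \<Longrightarrow> F_inv nrm s \<le> F_inv nrm t"
  unfolding F_inv_def by (rule cInf_superset_mono) (use superlevel in auto)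

section \<open>The first absolute moment of the quantile function\<close>

text \<open>The quantile function compressed to \<open>(0, 1/2)\<close>, the form in which it enters
  \<^const>\<open>eta\<close>; working with it throughout avoids a change of variables.\<close>

definition q :: "real \<Rightarrow> real" where
  "q s = F_inv nrm (2 * s)"

lemma q_measurable: "q \<in> borel_measurable half"
proof -
  have "q \<in> borel_measurable (restrict_space borel {0<..<1 / 2})"
    by (rule borel_measurable_mono_on_fnc) (auto simp: q_def mono_on_def intro: F_inv_mono)
  then have "(\<lambda>s. indicator {0<..<1 / 2} s *\<^sub>R q s) \<in> borel_measurable borel"
    by (subst (asm) borel_measurable_restrict_space_iff) auto
  then have "(\<lambda>s. indicator {0<..<1 / 2} s *\<^sub>R q s) \<in> borel_measurable lebesgue"
    by (intro measurable_completion) simp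
  then show ?thesis
    by (subst borel_measurable_restrict_space_iff) auto
qed

lemma integrable_increment: "integrable half (\<lambda>s. \<bar>b - q s\<bar> - \<bar>a - q s\<bar>)"
  by (rule Bochner_Integration.integrable_bound[OF half_const(1)[of "b - a"]])
     (use q_measurable in \<open>auto\<close>)

text \<open>For \<open>2s \<le> F(a)\<close> the point \<open>q(s)\<close> lies to the left of \<open>a\<close> and the increment is exactly \<open>b - a\<close>;
  otherwise it is at least \<open>-(b - a)\<close> by the triangle inequality. The upper bound is dual, with
  \<open>2s > F(b)\<close> forcing \<open>q(s)\<close> to the right of \<open>b\<close>.\<close>

lemma increment_between:
  assumes "a < b" "s \<in> {0<..<1 / 2}"
  shows "(b - a) * (2 * indicator {..F nrm a / 2} s - 1) \<le> \<bar>b - q s\<bar> - \<bar>a - q s\<bar>"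
    "\<bar>b - q s\<bar> - \<bar>a - q s\<bar> \<le> (b - a) * (2 * indicator {..F nrm b / 2} s - 1)"
proof -
  show "(b - a) * (2 * indicator {..F nrm a / 2} s - 1) \<le> \<bar>b - q s\<bar> - \<bar>a - q s\<bar>"
    using F_inv_le[of "2 * s" a] assms by (auto simp: q_def indicator_def)
  show "\<bar>b - q s\<bar> - \<bar>a - q s\<bar> \<le> (b - a) * (2 * indicator {..F nrm b / 2} s - 1)"
    using le_F_inv[of "2 * s" b] assms by (auto simp: q_def indicator_def)
qed

lemma integral_increment_between:
  assumes "a < b"
  shows "(b - a) * (2 * F nrm a - 1) \<le> 2 * (LINT s|half. \<bar>b - q s\<bar> - \<bar>a - q s\<bar>)"
    "2 * (LINT s|half. \<bar>b - q s\<bar> - \<bar>a - q s\<bar>) \<le> (b - a) * (2 * F nrm b - 1)"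
proof -
  have seg: "integrable half (\<lambda>s. (b - a) * (2 * indicator {..F nrm x / 2} s - 1))"
    "(LINT s|half. (b - a) * (2 * indicator {..F nrm x / 2} s - 1)) = (b - a) * (F nrm x - 1 / 2)" for x
    using half_initial_segment[OF F_bounds[of x]] half_const[of 1] by (simp_all)
  have "(b - a) * (F nrm a - 1 / 2) \<le> (LINT s|half. \<bar>b - q s\<bar> - \<bar>a - q s\<bar>)"
    unfolding seg(2)[symmetric]
    by (rule integral_mono[OF seg(1) integrable_increment])
       (use increment_between(1)[OF assms] in auto)
  then show "(b - a) * (2 * F nrm a - 1) \<le> 2 * (LINT s|half. \<bar>b - q s\<bar> - \<bar>a - q s\<bar>)"
    by (simp add: field_simps)
  have "(LINT s|half. \<bar>b - q s\<bar> - \<bar>a - q s\<bar>) \<le> (b - a) * (F nrm b - 1 / 2)"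
    unfolding seg(2)[symmetric]
    by (rule integral_mono[OF integrable_increment seg(1)])
       (use increment_between(2)[OF assms] in auto)
  then show "2 * (LINT s|half. \<bar>b - q s\<bar> - \<bar>a - q s\<bar>) \<le> (b - a) * (2 * F nrm b - 1)"
    by (simp add: field_simps)
qed

text \<open>The bounds for the increments of \<open>N\<close> and of the integral coincide, so their difference has
  increments dominated by those of \<open>2k F\<close>, with the factor \<open>b - a\<close> in front.\<close>

lemma N_increment: "N nrm u - N nrm 0 = 2 * k nrm * (LINT s|half. \<bar>u - q s\<bar> - \<bar>q s\<bar>)"
proof -
  define J where "J u = (LINT s|half. \<bar>u - q s\<bar> - \<bar>0 - q s\<bar>)" for u
  define D where "D u = N nrm u - 2 * k nrm * J u" for u
  have J: "J b - J a = (LINT s|half. \<bar>b - q s\<bar> - \<bar>a - q s\<bar>)" for a b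
    unfolding J_def
    by (subst Bochner_Integration.integral_diff[symmetric]) (simp_all only: integrable_increment, simp)
  have "\<bar>D b - D a\<bar> \<le> (b - a) * (2 * k nrm * F nrm b - 2 * k nrm * F nrm a)" if "a < b" for a b
  proof -
    have "k nrm * ((b - a) * (2 * F nrm a - 1)) \<le> k nrm * (2 * (J b - J a))"
      "k nrm * (2 * (J b - J a)) \<le> k nrm * ((b - a) * (2 * F nrm b - 1))"
      unfolding J using integral_increment_between[OF that] k_pos by (auto intro: mult_left_mono)
    with F_increment[OF that] show ?thesis
      by (simp add: D_def algebra_simps abs_le_iff)
  qed
  from constant_if_dominated_increments[of D, OF this]
  have "D u = D 0"
    by (metis linorder_less_linear)
  then show ?thesis
    by (simp add: D_def J_def)
qed

text \<open>The second difference \<open>\<bar>r - q\<bar> + \<bar>-r - q\<bar> - 2\<bar>q\<bar>\<close> equals \<open>2r - 2 min r \<bar>q\<bar>\<close>, so the truncated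
  moment is a second difference of \<open>N\<close>.\<close>

lemma integral_truncated:
  assumes "0 \<le> r"
  shows "integrable half (\<lambda>s. min r \<bar>q s\<bar>)"
    "2 * k nrm * (LINT s|half. min r \<bar>q s\<bar>) = N nrm 0 - c_fun nrm r / 2"
proof -
  have min: "min r \<bar>q s\<bar> = r - ((\<bar>r - q s\<bar> - \<bar>q s\<bar>) + (\<bar>- r - q s\<bar> - \<bar>q s\<bar>)) / 2" for s
    using assms by (auto simp: min_def abs_if field_simps)
  have ints: "integrable half (\<lambda>s. \<bar>r - q s\<bar> - \<bar>q s\<bar>)" "integrable half (\<lambda>s. \<bar>- r - q s\<bar> - \<bar>q s\<bar>)"
    using integrable_increment[of _ 0] by simp_all
  show "integrable half (\<lambda>s. min r \<bar>q s\<bar>)"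
    unfolding min by (intro Bochner_Integration.integrable_diff half_const integrable_divide
        Bochner_Integration.integrable_add ints)
  have "(LINT s|half. min r \<bar>q s\<bar>) = r / 2 -
     ((LINT s|half. \<bar>r - q s\<bar> - \<bar>q s\<bar>) + (LINT s|half. \<bar>- r - q s\<bar> - \<bar>q s\<bar>)) / 2"
    unfolding min half_const(2)[of r, symmetric]
    by (simp only: Bochner_Integration.integral_diff[OF half_const(1) integrable_divide[OF
          Bochner_Integration.integrable_add[OF ints]]]
        integral_divide_zero Bochner_Integration.integral_add[OF ints])
  then have "2 * k nrm * (LINT s|half. min r \<bar>q s\<bar>) = 2 * k nrm * (r / 2 -
     ((LINT s|half. \<bar>r - q s\<bar> - \<bar>q s\<bar>) + (LINT s|half. \<bar>- r - q s\<bar> - \<bar>q s\<bar>)) / 2)"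
    by (simp only:)
  also have "\<dots> = k nrm * r - ((N nrm r - N nrm 0) + (N nrm (- r) - N nrm 0)) / 2"
    unfolding N_increment by algebra
  finally show "2 * k nrm * (LINT s|half. min r \<bar>q s\<bar>) = N nrm 0 - c_fun nrm r / 2"
    using c_fun_N[OF assms] by (simp add: field_simps)
qed

text \<open>Integrability of \<open>q\<close> reflects that \<open>c\<close> is finite: the truncated moments increase to a finite
  limit.\<close>

lemma quantile_first_moment:
  shows "integrable half (\<lambda>s. \<bar>q s\<bar>)"
    "2 * k nrm * (LINT s|half. \<bar>q s\<bar>) = N nrm 0 - c nrm / 2"
proof -
  define I where "I n = (LINT s|half. min (real n) \<bar>q s\<bar>)" for n
  have I: "I n = (N nrm 0 - c_fun nrm (real n) / 2) / (2 * k nrm)" for n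
    using integral_truncated(2)[of "real n"] k_pos by (simp add: I_def field_simps)
  have lim: "I \<longlonglongrightarrow> (N nrm 0 - c nrm / 2) / (2 * k nrm)"
    unfolding I using k_pos
    by (intro tendsto_intros filterlim_compose[OF c_fun_tendsto filterlim_real_sequentially]) auto
  have ptw: "(\<lambda>n. min (real n) \<bar>q s\<bar>) \<longlonglongrightarrow> \<bar>q s\<bar>" for s
  proof (rule tendsto_eventually)
    obtain m where "\<bar>q s\<bar> \<le> real m"
      using real_arch_simple by blast
    then show "\<forall>\<^sub>F n in sequentially. min (real n) \<bar>q s\<bar> = \<bar>q s\<bar>"
      by (intro eventually_sequentiallyI[of m]) auto
  qed
  have mono: "mono (\<lambda>n. min (real n) \<bar>q s\<bar>)" for s
    by (auto simp: mono_def)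
  have int: "integrable half (\<lambda>s. min (real n) \<bar>q s\<bar>)" for n
    by (rule integral_truncated) simp
  have meas: "(\<lambda>s. \<bar>q s\<bar>) \<in> borel_measurable half"
    by (rule borel_measurable_abs[OF q_measurable])
  have "AE s in half. mono (\<lambda>n. min (real n) \<bar>q s\<bar>)"
    "AE s in half. (\<lambda>n. min (real n) \<bar>q s\<bar>) \<longlonglongrightarrow> \<bar>q s\<bar>"
    by (rule AE_I2, rule mono, rule AE_I2, rule ptw)
  note conv = int this lim[unfolded I_def] meas
  show "integrable half (\<lambda>s. \<bar>q s\<bar>)"
    by (rule integrable_monotone_convergence[OF conv])
  have "(LINT s|half. \<bar>q s\<bar>) = (N nrm 0 - c nrm / 2) / (2 * k nrm)"
    by (rule integral_monotone_convergence[OF conv])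
  then show "2 * k nrm * (LINT s|half. \<bar>q s\<bar>) = N nrm 0 - c nrm / 2"
    using k_pos by simp
qed

lemma q_integrable: "integrable half q"
  using quantile_first_moment(1) q_measurable by (rule integrable_abs_cancel)

lemma N_representation: "N nrm u = 2 * k nrm * (LINT s|half. \<bar>u - q s\<bar>) + c nrm / 2"
proof -
  have "(LINT s|half. \<bar>u - q s\<bar> - \<bar>q s\<bar>) = (LINT s|half. \<bar>u - q s\<bar>) - (LINT s|half. \<bar>q s\<bar>)"
    by (intro Bochner_Integration.integral_diff integrable_abs Bochner_Integration.integrable_diff
        half_const q_integrable)
  with N_increment[of u] quantile_first_moment(2) show ?thesis
    by (simp add: algebra_simps)
qed

section \<open>The representation and the embedding\<close>

lemma combination: "u * xi nrm s + v * eta nrm s =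
    (if s < 1 / 2 then 2 * k nrm * (u - v * q s) else v * c nrm)"
  by (simp add: xi_def eta_def q_def algebra_simps)

lemma combination_integrable: "integrable leb01 (\<lambda>s. u * xi nrm s + v * eta nrm s)"
  unfolding combination
  by (intro leb01_splice(1) integrable_mult_right Bochner_Integration.integrable_diff
      half_const q_integrable)

lemma norm_representation: "nrm (u, v) = (LINT s|leb01. \<bar>u * xi nrm s + v * eta nrm s\<bar>)"
proof -
  have "(LINT s|leb01. \<bar>u * xi nrm s + v * eta nrm s\<bar>) =
     (LINT s|leb01. (if s < 1 / 2 then 2 * k nrm * \<bar>u - v * q s\<bar> else \<bar>v\<bar> * c nrm))"
    unfolding combination using k_pos c_nonneg
    by (intro Bochner_Integration.integral_cong) (auto simp: abs_mult)
  also have "\<dots> = (LINT s|half. 2 * k nrm * \<bar>u - v * q s\<bar>) + \<bar>v\<bar> * c nrm / 2"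
    by (intro leb01_splice(2) integrable_mult_right integrable_abs Bochner_Integration.integrable_diff
      half_const q_integrable)
  also have "\<dots> = 2 * k nrm * (LINT s|half. \<bar>u - v * q s\<bar>) + \<bar>v\<bar> * c nrm / 2"
    by simp
  also have "\<dots> = nrm (u, v)"
  proof (cases "v = 0")
    case True
    then show ?thesis by (simp add: half_const(2) horizontal del: lebesgue_integral_const)
  next
    case False
    have "\<bar>u - v * q s\<bar> = \<bar>v\<bar> * \<bar>u / v - q s\<bar>" for s
      using False by (simp add: abs_mult[symmetric] algebra_simps)
    then have "2 * k nrm * (LINT s|half. \<bar>u - v * q s\<bar>) + \<bar>v\<bar> * c nrm / 2 = \<bar>v\<bar> * N nrm (u / v)"
      unfolding N_representation[of "u / v"] by (simp add: algebra_simps)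
    also have "\<dots> = nrm (u, v)"
      using homogeneous[of v "u / v" 1] False by (simp add: N_def)
    finally show ?thesis .
  qed
  finally show ?thesis by simp
qed

end

lemma L1_class_linear:
  assumes "\<And>u v. integrable leb01 (\<lambda>s. u * f s + v * g s)"
  shows "linear (\<lambda>(u, v). L1_class (\<lambda>s. u * f s + v * g s))"
proof -
  have eq: "L1_eq (\<lambda>s. u * f s + v * g s) (\<lambda>s. u * f s + v * g s)" for u v
    using assms by (simp add: L1_eq_def)
  show ?thesis
    by (rule linearI)
       (auto simp: plus_L1.abs_eq[OF eq eq] scaleR_L1.abs_eq[OF eq] algebra_simps)
qed

theorem mainTheorem2:
  fixes nrm :: "real \<times> real \<Rightarrow> real"
  assumes "is_norm nrm"
  shows "(c_fun nrm \<longlongrightarrow> c nrm) at_top \<and> 0 \<le> c nrm \<and>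
    (\<forall>u v. integrable leb01 (\<lambda>s. u * xi nrm s + v * eta nrm s) \<and>
           nrm (u, v) = (LINT s|leb01. \<bar>u * xi nrm s + v * eta nrm s\<bar>)) \<and>
    (let T = (\<lambda>(u, v). L1_class (\<lambda>s. u * xi nrm s + v * eta nrm s))
     in linear T \<and> (\<forall>p. norm (T p) = nrm p))"
proof -
  interpret plane_norm nrm
    by unfold_locales (rule assms)
  have "norm (L1_class (\<lambda>s. u * xi nrm s + v * eta nrm s)) = nrm (u, v)" for u v
    using combination_integrable[of u v] norm_representation[of u v]
    by (subst norm_L1.abs_eq) (simp_all add: L1_eq_def)
  then show ?thesis
    using c_fun_tendsto c_nonneg combination_integrable norm_representation
      L1_class_linear[OF combination_integrable]
    by (simp add: Let_def split_beta)
qed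

end
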